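(* Let $R$ be a ring and let $M$ be a left $R$-module. If $M$ is Rad-supplementing, then every direct summand of $M$ is Rad-supplementing.
   Context: Rings are associative with identity and modules are unitary left modules. For a module $M$, $\operatorname{Rad} M$ denotes the radical of $M$ (the intersection of all maximal submodules of $M$, equal to $M$ if there are none). For submodules $U,V$ of a module $N$, $V$ is a Rad-supplement of $U$ in $N$ if $U+V=N$ and $U\cap V\subseteq \operatorname{Rad} V$. A module $M$ is Rad-supplementing if $M$ has a Rad-supplement in every module $N$ that contains $M$ as a submodule. *)

theory Defs
  imports "HOL-Algebra.Module" "HOL-Algebra.AbelCoset" "HOL-Library.Infinite_Typeclass"
begin

text \<open>The locale \<^verbatim>\<open>module\<close> of HOL-Algebra requires a commutative ring of scalars. The following is
  the same list of axioms over an arbitrary ring. The record type of modules is reused; its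
  multiplicative fields on the module side are irrelevant.\<close>

locale left_module = R?: ring + M?: abelian_group M for M (structure) +
  assumes smult_closed [simp, intro]:
      "\<lbrakk>a \<in> carrier R; x \<in> carrier M\<rbrakk> \<Longrightarrow> a \<odot>\<^bsub>M\<^esub> x \<in> carrier M"
    and smult_l_distr:
      "\<lbrakk>a \<in> carrier R; b \<in> carrier R; x \<in> carrier M\<rbrakk> \<Longrightarrow>
        (a \<oplus> b) \<odot>\<^bsub>M\<^esub> x = a \<odot>\<^bsub>M\<^esub> x \<oplus>\<^bsub>M\<^esub> b \<odot>\<^bsub>M\<^esub> x"
    and smult_r_distr:
      "\<lbrakk>a \<in> carrier R; x \<in> carrier M; y \<in> carrier M\<rbrakk> \<Longrightarrow>
        a \<odot>\<^bsub>M\<^esub> (x \<oplus>\<^bsub>M\<^esub> y) = a \<odot>\<^bsub>M\<^esub> x \<oplus>\<^bsub>M\<^esub> a \<odot>\<^bsub>M\<^esub> y"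
    and smult_assoc:
      "\<lbrakk>a \<in> carrier R; b \<in> carrier R; x \<in> carrier M\<rbrakk> \<Longrightarrow>
        (a \<otimes> b) \<odot>\<^bsub>M\<^esub> x = a \<odot>\<^bsub>M\<^esub> (b \<odot>\<^bsub>M\<^esub> x)"
    and smult_one [simp]:
      "x \<in> carrier M \<Longrightarrow> \<one> \<odot>\<^bsub>M\<^esub> x = x"

definition maximal_submodule ::
    "('a, 'r) ring_scheme \<Rightarrow> ('a, 'b, 'm) module_scheme \<Rightarrow> 'b set \<Rightarrow> bool" where
  "maximal_submodule R M K \<longleftrightarrow>
     submodule K R M \<and> K \<noteq> carrier M \<and>
     (\<forall>L. submodule L R M \<and> K \<subseteq> L \<longrightarrow> L = K \<or> L = carrier M)"

text \<open>If there are no maximal submodules, the condition is vacuous and the radical is the whole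
  carrier.\<close>

definition Rad :: "('a, 'r) ring_scheme \<Rightarrow> ('a, 'b, 'm) module_scheme \<Rightarrow> 'b set" where
  "Rad R M = {x \<in> carrier M. \<forall>K. maximal_submodule R M K \<longrightarrow> x \<in> K}"

text \<open>A submodule \<^verbatim>\<open>V\<close> of \<^verbatim>\<open>N\<close>, regarded as a module in its own right, is
  \<^verbatim>\<open>N\<lparr>carrier := V\<rparr>\<close>.\<close>

definition rad_supplement ::
    "('a, 'r) ring_scheme \<Rightarrow> ('a, 'b, 'm) module_scheme \<Rightarrow> 'b set \<Rightarrow> 'b set \<Rightarrow> bool" where
  "rad_supplement R N U V \<longleftrightarrow>
     submodule U R N \<and> submodule V R N \<and>
     U <+>\<^bsub>N\<^esub> V = carrier N \<and> U \<inter> V \<subseteq> Rad R (N\<lparr>carrier := V\<rparr>)"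

definition direct_summand ::
    "('a, 'r) ring_scheme \<Rightarrow> ('a, 'b, 'm) module_scheme \<Rightarrow> 'b set \<Rightarrow> bool" where
  "direct_summand R M A \<longleftrightarrow>
     submodule A R M \<and>
     (\<exists>B. submodule B R M \<and> A <+>\<^bsub>M\<^esub> B = carrier M \<and> A \<inter> B = {\<zero>\<^bsub>M\<^esub>})"

definition module_embedding ::
    "('a, 'r) ring_scheme \<Rightarrow> ('a, 'b, 'm) module_scheme \<Rightarrow> ('a, 'c, 'n) module_scheme
      \<Rightarrow> ('b \<Rightarrow> 'c) \<Rightarrow> bool" where
  "module_embedding R M N f \<longleftrightarrow>
     f \<in> hom (add_monoid M) (add_monoid N) \<and>
     (\<forall>a \<in> carrier R. \<forall>x \<in> carrier M. f (a \<odot>\<^bsub>M\<^esub> x) = a \<odot>\<^bsub>N\<^esub> f x) \<and>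
     inj_on f (carrier M)"

text \<open>``Every module \<^verbatim>\<open>N\<close> containing \<^verbatim>\<open>M\<close>'' ranges over modules of unbounded size, while a HOL
  formula cannot quantify over types. The type \<^verbatim>\<open>'u\<close> is therefore an explicit size parameter:
  the modules \<^verbatim>\<open>N\<close> have their carriers in \<^verbatim>\<open>'b + 'u\<close>, a type that always has room for \<^verbatim>\<open>M\<close> itself.
  Up to isomorphism every module occurs as such an \<^verbatim>\<open>N\<close> once \<^verbatim>\<open>'u\<close> is large enough, so that
  \<^verbatim>\<open>M\<close> is Rad-supplementing in the unrestricted sense iff the predicate holds for all \<^verbatim>\<open>'u\<close>.
  The sort \<^verbatim>\<open>infinite\<close> makes \<^verbatim>\<open>'b + 'u\<close> infinite, so that the modules with carrier in it are closed,
  up to isomorphism, under finite direct sums. Containment of \<^verbatim>\<open>M\<close> in \<^verbatim>\<open>N\<close> is expressed by an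
  embedding, with \<^verbatim>\<open>M\<close> identified with its image.\<close>

definition rad_supplementing ::
    "'u::infinite itself \<Rightarrow> ('a, 'r) ring_scheme \<Rightarrow> ('a, 'b, 'm) module_scheme \<Rightarrow> bool" where
  "rad_supplementing (_ :: 'u itself) R M \<longleftrightarrow>
     (\<forall>(N :: ('a, 'b + 'u) module) f.
        left_module R N \<and> module_embedding R M N f \<longrightarrow>
        (\<exists>V. rad_supplement R N (f ` carrier M) V))"

end

theory Submission
  imports Defs
begin

text \<open>Let \<open>M = A \<oplus> B\<close> and let \<open>N\<close> contain \<open>A\<close>. Then \<open>N \<oplus> B\<close> contains \<open>M\<close>, so \<open>M\<close> has a
  Rad-supplement \<open>V\<close> in it. The projection \<open>N \<oplus> B \<rightarrow> N\<close> has kernel \<open>B \<subseteq> M\<close> and maps \<open>M\<close> onto \<open>A\<close>.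
  Rad-supplements of a submodule containing the kernel of an epimorphism are mapped to
  Rad-supplements of its image, because epimorphisms map radicals into radicals; so the image
  of \<open>V\<close> is a Rad-supplement of \<open>A\<close> in \<open>N\<close>. Since \<open>'b + 'u\<close> is infinite, a copy of \<open>N \<oplus> B\<close>
  lives on that type.\<close>

section \<open>Submodules\<close>

lemma left_moduleI:
  fixes R (structure) and M (structure)
  assumes "ring R" and "abelian_group M"
    and "\<And>a x. \<lbrakk>a \<in> carrier R; x \<in> carrier M\<rbrakk> \<Longrightarrow> a \<odot>\<^bsub>M\<^esub> x \<in> carrier M"
    and "\<And>a b x. \<lbrakk>a \<in> carrier R; b \<in> carrier R; x \<in> carrier M\<rbrakk> \<Longrightarrow>
      (a \<oplus> b) \<odot>\<^bsub>M\<^esub> x = a \<odot>\<^bsub>M\<^esub> x \<oplus>\<^bsub>M\<^esub> b \<odot>\<^bsub>M\<^esub> x"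
    and "\<And>a x y. \<lbrakk>a \<in> carrier R; x \<in> carrier M; y \<in> carrier M\<rbrakk> \<Longrightarrow>
      a \<odot>\<^bsub>M\<^esub> (x \<oplus>\<^bsub>M\<^esub> y) = a \<odot>\<^bsub>M\<^esub> x \<oplus>\<^bsub>M\<^esub> a \<odot>\<^bsub>M\<^esub> y"
    and "\<And>a b x. \<lbrakk>a \<in> carrier R; b \<in> carrier R; x \<in> carrier M\<rbrakk> \<Longrightarrow>
      (a \<otimes> b) \<odot>\<^bsub>M\<^esub> x = a \<odot>\<^bsub>M\<^esub> (b \<odot>\<^bsub>M\<^esub> x)"
    and "\<And>x. x \<in> carrier M \<Longrightarrow> \<one> \<odot>\<^bsub>M\<^esub> x = x"
  shows "left_module R M"
  by (intro left_module.intro left_module_axioms.intro assms)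

context left_module
begin

lemma smult_zero_left [simp]:
  assumes "x \<in> carrier M"
  shows "\<zero> \<odot>\<^bsub>M\<^esub> x = \<zero>\<^bsub>M\<^esub>"
proof -
  have "\<zero> \<odot>\<^bsub>M\<^esub> x \<oplus>\<^bsub>M\<^esub> \<zero> \<odot>\<^bsub>M\<^esub> x = \<zero> \<odot>\<^bsub>M\<^esub> x"
    using smult_l_distr[of \<zero> \<zero> x] assms by simp
  then show ?thesis
    using assms by (simp add: M.add.r_cancel_one)
qed

text \<open>Expresses additive inverses through scalars, by
  \<open>(-1) x + x = (-1 + 1) x = 0 x = 0\<close>. Whatever respects scalars then respects
  inverses.\<close>

lemma smult_minus_one:
  assumes "x \<in> carrier M"
  shows "(\<ominus> \<one>) \<odot>\<^bsub>M\<^esub> x = \<ominus>\<^bsub>M\<^esub> x"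
proof -
  have "(\<ominus> \<one>) \<odot>\<^bsub>M\<^esub> x \<oplus>\<^bsub>M\<^esub> x = (\<ominus> \<one> \<oplus> \<one>) \<odot>\<^bsub>M\<^esub> x"
    using smult_l_distr[of "\<ominus> \<one>" \<one> x] assms by simp
  also have "\<dots> = \<zero>\<^bsub>M\<^esub>"
    using assms by (simp add: R.l_neg)
  finally show ?thesis
    using assms by (metis M.minus_equality R.add.inv_closed R.one_closed smult_closed)
qed

text \<open>The subgroup inverses come from closure under scalars, because
  \<open>- x = (-1) x\<close>. This gives a criterion stated purely in the operations of
  \<open>M\<close>.\<close>

lemma submodule_iff:
  "submodule H R M \<longleftrightarrow>
     H \<subseteq> carrier M \<and> \<zero>\<^bsub>M\<^esub> \<in> H \<and> (\<forall>x\<in>H. \<forall>y\<in>H. x \<oplus>\<^bsub>M\<^esub> y \<in> H) \<and>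
     (\<forall>a\<in>carrier R. \<forall>x\<in>H. a \<odot>\<^bsub>M\<^esub> x \<in> H)" (is "_ \<longleftrightarrow> ?P")
proof
  assume "submodule H R M"
  then interpret H: submodule H R M .
  show ?P
    using H.subset H.one_closed H.m_closed H.smult_closed by auto
next
  assume P: ?P
  have "\<ominus>\<^bsub>M\<^esub> x \<in> H" if "x \<in> H" for x
  proof -
    have "(\<ominus> \<one>) \<odot>\<^bsub>M\<^esub> x \<in> H"
      using P that by simp
    then show ?thesis
      using P that smult_minus_one[of x] by (metis subsetD)
  qed
  then show "submodule H R M"
    using P by (intro submodule.intro subgroup.intro submodule_axioms.intro)
      (auto simp: a_inv_def)
qed

lemma submodule_a_inv_closed:
  assumes "submodule H R M" "x \<in> H"
  shows "\<ominus>\<^bsub>M\<^esub> x \<in> H"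
  using subgroup.m_inv_closed[OF submodule.axioms(1)[OF assms(1)] assms(2)]
  by (simp add: a_inv_def)

text \<open>Membership in \<open>H\<close> depends only on the coset modulo \<open>H\<close>. It
  serves to pass from an element to another one that differs from it by a member of
  \<open>H\<close>.\<close>

lemma submodule_diff_mem_iff:
  assumes "submodule H R M" "x \<in> carrier M" "y \<in> H"
  shows "x \<ominus>\<^bsub>M\<^esub> y \<in> H \<longleftrightarrow> x \<in> H"
proof
  have y: "y \<in> carrier M" "\<ominus>\<^bsub>M\<^esub> y \<in> H"
    using assms submodule_iff submodule_a_inv_closed by auto
  {
    assume "x \<ominus>\<^bsub>M\<^esub> y \<in> H"
    then have "(x \<ominus>\<^bsub>M\<^esub> y) \<oplus>\<^bsub>M\<^esub> y \<in> H"
      using assms submodule_iff by auto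
    then show "x \<in> H"
      using assms y by (simp add: a_minus_def M.a_assoc M.l_neg)
  next
    assume "x \<in> H"
    then show "x \<ominus>\<^bsub>M\<^esub> y \<in> H"
      using assms y submodule_iff by (auto simp: a_minus_def)
  }
qed

text \<open>The radical of a Rad-supplement is taken in that submodule as a module in its own right,
  and the summands \<open>A\<close> and \<open>B\<close> enter as modules too.\<close>

lemma left_module_submodule:
  assumes "submodule H R M"
  shows "left_module R (M\<lparr>carrier := H\<rparr>)"
proof -
  note H = assms[unfolded submodule_iff]
  then have HM: "x \<in> carrier M" if "x \<in> H" for x
    using that by auto
  have inv: "\<exists>y\<in>H. y \<oplus>\<^bsub>M\<^esub> x = \<zero>\<^bsub>M\<^esub>" if "x \<in> H" for x
    using submodule_a_inv_closed[OF assms that] HM[OF that] by (auto intro: M.l_neg)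
  show ?thesis
  proof (rule left_moduleI)
    show "abelian_group (M\<lparr>carrier := H\<rparr>)"
    proof (rule abelian_groupI)
      fix x y assume "x \<in> carrier (M\<lparr>carrier := H\<rparr>)" "y \<in> carrier (M\<lparr>carrier := H\<rparr>)"
      then show "x \<oplus>\<^bsub>M\<lparr>carrier := H\<rparr>\<^esub> y = y \<oplus>\<^bsub>M\<lparr>carrier := H\<rparr>\<^esub> x"
        using HM by (simp add: M.a_comm)
    qed (use H HM inv in \<open>simp_all add: M.a_assoc\<close>)
  qed (use H HM in \<open>simp_all add: R.ring_axioms smult_l_distr smult_r_distr smult_assoc\<close>)
qed

end

section \<open>Module homomorphisms\<close>

text \<open>The homomorphism part of \<open>module_embedding\<close>, separated from injectivity
  because projections have to be treated as well.\<close>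

definition module_map ::
    "('a, 'r) ring_scheme \<Rightarrow> ('a, 'b, 'm) module_scheme \<Rightarrow> ('a, 'c, 'n) module_scheme
      \<Rightarrow> ('b \<Rightarrow> 'c) \<Rightarrow> bool" where
  "module_map R M N f \<longleftrightarrow>
     f \<in> hom (add_monoid M) (add_monoid N) \<and>
     (\<forall>a \<in> carrier R. \<forall>x \<in> carrier M. f (a \<odot>\<^bsub>M\<^esub> x) = a \<odot>\<^bsub>N\<^esub> f x)"

lemma module_embedding_iff: "module_embedding R M N f \<longleftrightarrow> module_map R M N f \<and> inj_on f (carrier M)"
  by (auto simp: module_embedding_def module_map_def)

lemma module_mapI:
  assumes "\<And>x. x \<in> carrier M \<Longrightarrow> f x \<in> carrier N"
    and "\<And>x y. \<lbrakk>x \<in> carrier M; y \<in> carrier M\<rbrakk> \<Longrightarrow> f (x \<oplus>\<^bsub>M\<^esub> y) = f x \<oplus>\<^bsub>N\<^esub> f y"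
    and "\<And>a x. \<lbrakk>a \<in> carrier R; x \<in> carrier M\<rbrakk> \<Longrightarrow> f (a \<odot>\<^bsub>M\<^esub> x) = a \<odot>\<^bsub>N\<^esub> f x"
  shows "module_map R M N f"
  using assms by (auto simp: module_map_def hom_def)

lemma module_mapD:
  assumes "module_map R M N f"
  shows "x \<in> carrier M \<Longrightarrow> f x \<in> carrier N"
    and "\<lbrakk>x \<in> carrier M; y \<in> carrier M\<rbrakk> \<Longrightarrow> f (x \<oplus>\<^bsub>M\<^esub> y) = f x \<oplus>\<^bsub>N\<^esub> f y"
    and "\<lbrakk>a \<in> carrier R; x \<in> carrier M\<rbrakk> \<Longrightarrow> f (a \<odot>\<^bsub>M\<^esub> x) = a \<odot>\<^bsub>N\<^esub> f x"
  using assms by (auto simp: module_map_def hom_def)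

lemma module_map_comp:
  assumes "module_map R L M f" "module_map R M N g"
  shows "module_map R L N (g \<circ> f)"
  by (rule module_mapI) (simp_all add: module_mapD[OF assms(1)] module_mapD[OF assms(2)])

text \<open>Serves to split an element of an internal direct sum into its components, and to undo a
  transport of structure.\<close>

lemma module_map_inv_into:
  assumes "left_module R M" and f: "module_map R M N f" "bij_betw f (carrier M) (carrier N)"
  shows "module_map R N M (inv_into (carrier M) f)"
proof -
  interpret left_module R M by fact
  have inj: "inj_on f (carrier M)" and im: "f ` carrier M = carrier N"
    using f(2) by (auto simp: bij_betw_def)
  have carrier: "inv_into (carrier M) f y \<in> carrier M" if "y \<in> carrier N" for y
    using that im by (simp add: inv_into_into)
  show ?thesis
  proof (rule module_mapI)
    fix x y assume "x \<in> carrier N" "y \<in> carrier N"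
    then show "inv_into (carrier M) f (x \<oplus>\<^bsub>N\<^esub> y) =
        inv_into (carrier M) f x \<oplus>\<^bsub>M\<^esub> inv_into (carrier M) f y"
      \<comment> \<open>By injectivity it is enough that \<open>f\<close> sends the claimed value to
        the argument of the inverse.\<close>
      using im by (intro inv_into_f_eq[OF inj])
        (simp_all add: carrier module_mapD(2)[OF f(1)] f_inv_into_f)
  next
    fix a x assume "a \<in> carrier R" "x \<in> carrier N"
    then show "inv_into (carrier M) f (a \<odot>\<^bsub>N\<^esub> x) = a \<odot>\<^bsub>M\<^esub> inv_into (carrier M) f x"
      using im by (intro inv_into_f_eq[OF inj])
        (simp_all add: carrier module_mapD(3)[OF f(1)] f_inv_into_f)
  qed (rule carrier)
qed

section \<open>Epimorphisms, radicals and images of Rad-supplements\<close>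

locale module_epi = P: left_module R P + Q: left_module R Q
  for R (structure) and P (structure) and Q (structure) +
  fixes g
  assumes map: "module_map R P Q g" and surj: "g ` carrier P = carrier Q"
begin

lemmas closed [simp, intro] = module_mapD(1)[OF map]
lemmas add [simp] = module_mapD(2)[OF map]
lemmas smult [simp] = module_mapD(3)[OF map]

lemma zero [simp]: "g \<zero>\<^bsub>P\<^esub> = \<zero>\<^bsub>Q\<^esub>"
  using smult[of \<zero> "\<zero>\<^bsub>P\<^esub>"] by simp

lemma a_inv [simp]: "x \<in> carrier P \<Longrightarrow> g (\<ominus>\<^bsub>P\<^esub> x) = \<ominus>\<^bsub>Q\<^esub> g x"
  using smult[of "\<ominus> \<one>" x] by (simp add: P.smult_minus_one Q.smult_minus_one)

lemma diff_zero_iff: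
  assumes "x \<in> carrier P" "y \<in> carrier P"
  shows "g (x \<ominus>\<^bsub>P\<^esub> y) = \<zero>\<^bsub>Q\<^esub> \<longleftrightarrow> g x = g y"
  using assms by (simp add: a_minus_def Q.add.inv_solve_right')

lemma submodule_image:
  assumes "submodule H R P"
  shows "submodule (g ` H) R Q"
proof -
  note H = assms[unfolded P.submodule_iff]
  have "\<zero>\<^bsub>Q\<^esub> \<in> g ` H"
    using H zero by (metis imageI)
  moreover have "g x \<oplus>\<^bsub>Q\<^esub> g y \<in> g ` H" if "x \<in> H" "y \<in> H" for x y
    using that H add[of x y, symmetric] by (metis imageI subsetD)
  moreover have "a \<odot>\<^bsub>Q\<^esub> g x \<in> g ` H" if "a \<in> carrier R" "x \<in> H" for a x
    using that H smult[of a x, symmetric] by (metis imageI subsetD)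
  ultimately show ?thesis
    using H by (auto simp: Q.submodule_iff)
qed

lemma submodule_preimage:
  assumes "submodule K R Q"
  shows "submodule {x \<in> carrier P. g x \<in> K} R P"
  using assms by (auto simp: P.submodule_iff Q.submodule_iff)

text \<open>An instance of the submodule correspondence. The image of a submodule \<open>L\<close>
  above the preimage lies above \<open>K\<close>, hence is \<open>K\<close> or all of
  \<open>Q\<close>; as \<open>L\<close> contains the kernel of \<open>g\<close>, the two cases pull
  back to \<open>L\<close>.\<close>

lemma maximal_submodule_preimage:
  assumes K: "maximal_submodule R Q K"
  shows "maximal_submodule R P {x \<in> carrier P. g x \<in> K}" (is "maximal_submodule R P ?K")
  unfolding maximal_submodule_def
proof (intro conjI allI impI)
  have sub: "submodule K R Q"
    using K by (simp add: maximal_submodule_def)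
  then have K_carrier: "K \<subseteq> carrier Q" and K_zero: "\<zero>\<^bsub>Q\<^esub> \<in> K"
    by (auto simp: Q.submodule_iff)
  show "submodule ?K R P"
    by (rule submodule_preimage[OF sub])
  show "?K \<noteq> carrier P"
  proof
    assume "?K = carrier P"
    then have "g ` carrier P \<subseteq> K"
      by blast
    then show False
      using K K_carrier surj by (simp add: maximal_submodule_def)
  qed
  fix L assume "submodule L R P \<and> ?K \<subseteq> L"
  then have L: "submodule L R P" and KL: "?K \<subseteq> L"
    by auto
  have L_carrier: "L \<subseteq> carrier P"
    using L by (simp add: P.submodule_iff)
  \<comment> \<open>By surjectivity each element of \<open>K\<close> has a preimage, which lies in
    \<open>?K\<close> and so in \<open>L\<close>.\<close>
  have "K \<subseteq> g ` L"
  proof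
    fix y assume "y \<in> K"
    moreover from this obtain x where "x \<in> carrier P" "y = g x"
      using K_carrier surj by blast
    ultimately show "y \<in> g ` L"
      using KL by blast
  qed
  then have "g ` L = K \<or> g ` L = carrier Q"
    using K submodule_image[OF L] by (simp add: maximal_submodule_def)
  then consider "g ` L = K" | "g ` L = carrier Q"
    by blast
  then show "L = ?K \<or> L = carrier P"
  proof cases
    case 1
    then have "L \<subseteq> ?K"
      using L_carrier by blast
    then show ?thesis
      using KL by blast
  next
    case 2
    have "x \<in> L" if x: "x \<in> carrier P" for x
    proof -
      obtain y where y: "y \<in> L" "g x = g y"
        using 2 closed[OF x] by (metis imageE)
      have "y \<in> carrier P"
        using y L_carrier by blast
      \<comment> \<open>The elements \<open>x\<close> and \<open>y\<close> have the same image, so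
        their difference lies in the kernel, which is part of \<open>?K\<close> because
        \<open>K\<close> contains zero.\<close>
      then have "x \<ominus>\<^bsub>P\<^esub> y \<in> ?K"
        using x y diff_zero_iff[of x y] K_zero by simp
      then show ?thesis
        using KL P.submodule_diff_mem_iff[OF L x y(1)] by blast
    qed
    then show ?thesis
      using L_carrier by blast
  qed
qed

text \<open>Preimages of maximal submodules of \<open>Q\<close> are maximal in \<open>P\<close>, so
  an element of the radical of \<open>P\<close> lies in all of them.\<close>

lemma Rad_image: "g ` Rad R P \<subseteq> Rad R Q"
  using maximal_submodule_preimage by (auto simp: Rad_def)

text \<open>Makes \<open>Rad_image\<close> available for a submodule \<open>V\<close> in place of
  \<open>P\<close>, since a Rad-supplement refers to the radical of \<open>V\<close> and not to that
  of \<open>P\<close>.\<close>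

lemma module_epi_restrict:
  assumes "submodule V R P"
  shows "module_epi R (P\<lparr>carrier := V\<rparr>) (Q\<lparr>carrier := g ` V\<rparr>) g"
proof -
  interpret V: left_module R "P\<lparr>carrier := V\<rparr>"
    by (rule P.left_module_submodule[OF assms])
  interpret gV: left_module R "Q\<lparr>carrier := g ` V\<rparr>"
    by (rule Q.left_module_submodule[OF submodule_image[OF assms]])
  have "V \<subseteq> carrier P"
    using assms by (simp add: P.submodule_iff)
  then show ?thesis
    by unfold_locales (auto intro!: module_mapI simp: subset_iff)
qed

text \<open>Sums are preserved by additivity. As \<open>U\<close> contains the kernel, every element
  of \<open>g(U) \<inter> g(V)\<close> comes from \<open>U \<inter> V\<close>, hence from the
  radical of \<open>V\<close>, which the restriction of \<open>g\<close> maps into the radical of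
  \<open>g(V)\<close>.\<close>

lemma rad_supplement_image:
  assumes UV: "rad_supplement R P U V"
    and ker: "\<And>x. \<lbrakk>x \<in> carrier P; g x = \<zero>\<^bsub>Q\<^esub>\<rbrakk> \<Longrightarrow> x \<in> U"
  shows "rad_supplement R Q (g ` U) (g ` V)"
proof -
  have U: "submodule U R P" and V: "submodule V R P"
    and sum: "U <+>\<^bsub>P\<^esub> V = carrier P"
    and rad: "U \<inter> V \<subseteq> Rad R (P\<lparr>carrier := V\<rparr>)"
    using UV by (auto simp: rad_supplement_def)
  have UP: "U \<subseteq> carrier P" and VP: "V \<subseteq> carrier P"
    using U V by (auto simp: P.submodule_iff)
  interpret V: module_epi R "P\<lparr>carrier := V\<rparr>" "Q\<lparr>carrier := g ` V\<rparr>" g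
    by (rule module_epi_restrict[OF V])
  have "g ` U <+>\<^bsub>Q\<^esub> g ` V = g ` (U <+>\<^bsub>P\<^esub> V)"
  proof -
    have "g (u \<oplus>\<^bsub>P\<^esub> v) = g u \<oplus>\<^bsub>Q\<^esub> g v" if "u \<in> U" "v \<in> V" for u v
      using that UP VP by (simp add: subset_iff)
    then show ?thesis
      unfolding set_add_def' by (simp add: image_UN)
  qed
  moreover have "g ` U \<inter> g ` V \<subseteq> Rad R (Q\<lparr>carrier := g ` V\<rparr>)"
  proof
    fix y assume "y \<in> g ` U \<inter> g ` V"
    then obtain u v where uv: "u \<in> U" "v \<in> V" "y = g u" "y = g v"
      by auto
    \<comment> \<open>The two preimages \<open>u\<close> and \<open>v\<close> of \<open>y\<close>
      may differ, but only by a kernel element; this places \<open>v\<close> in \<open>U\<close> as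
      well.\<close>
    have c: "u \<in> carrier P" "v \<in> carrier P"
      using uv UP VP by blast+
    then have "v \<ominus>\<^bsub>P\<^esub> u \<in> U"
      using uv diff_zero_iff[of v u] by (intro ker) simp_all
    then have "v \<in> U"
      using P.submodule_diff_mem_iff[OF U c(2) uv(1)] by blast
    then have "v \<in> Rad R (P\<lparr>carrier := V\<rparr>)"
      using uv(2) rad by blast
    then show "y \<in> Rad R (Q\<lparr>carrier := g ` V\<rparr>)"
      using V.Rad_image uv(4) by blast
  qed
  ultimately show ?thesis
    using submodule_image[OF U] submodule_image[OF V] sum surj
    by (simp add: rad_supplement_def)
qed

end

section \<open>Direct sums and transport of structure\<close>

text \<open>The external direct sum. It lives on a product type, whereas
  \<open>rad_supplementing\<close> ranges over modules on a sum type; \<open>transport\<close>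
  bridges this gap.\<close>

definition direct_sum ::
    "('a, 'b, 'm) module_scheme \<Rightarrow> ('a, 'c, 'n) module_scheme \<Rightarrow> ('a, 'b \<times> 'c) module" where
  "direct_sum M N =
     \<lparr>carrier = carrier M \<times> carrier N, mult = undefined, one = undefined,
      zero = (\<zero>\<^bsub>M\<^esub>, \<zero>\<^bsub>N\<^esub>),
      add = (\<lambda>x y. (fst x \<oplus>\<^bsub>M\<^esub> fst y, snd x \<oplus>\<^bsub>N\<^esub> snd y)),
      smult = (\<lambda>a x. (a \<odot>\<^bsub>M\<^esub> fst x, a \<odot>\<^bsub>N\<^esub> snd x))\<rparr>"

lemma direct_sum_simps [simp]:
  "carrier (direct_sum M N) = carrier M \<times> carrier N"
  "\<zero>\<^bsub>direct_sum M N\<^esub> = (\<zero>\<^bsub>M\<^esub>, \<zero>\<^bsub>N\<^esub>)"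
  "x \<oplus>\<^bsub>direct_sum M N\<^esub> y = (fst x \<oplus>\<^bsub>M\<^esub> fst y, snd x \<oplus>\<^bsub>N\<^esub> snd y)"
  "a \<odot>\<^bsub>direct_sum M N\<^esub> x = (a \<odot>\<^bsub>M\<^esub> fst x, a \<odot>\<^bsub>N\<^esub> snd x)"
  by (simp_all add: direct_sum_def)

lemma left_module_direct_sum:
  assumes "left_module R M" "left_module R N"
  shows "left_module R (direct_sum M N)"
proof -
  interpret M: left_module R M by fact
  interpret N: left_module R N by fact
  show ?thesis
  proof (rule left_moduleI)
    show "abelian_group (direct_sum M N)"
    proof (rule abelian_groupI)
      fix x assume "x \<in> carrier (direct_sum M N)"
      then show "\<exists>y\<in>carrier (direct_sum M N). y \<oplus>\<^bsub>direct_sum M N\<^esub> x = \<zero>\<^bsub>direct_sum M N\<^esub>"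
        by (intro bexI[of _ "(\<ominus>\<^bsub>M\<^esub> fst x, \<ominus>\<^bsub>N\<^esub> snd x)"]) (auto simp: M.M.l_neg N.M.l_neg)
    qed (auto simp: M.M.a_ac N.M.a_ac)
  qed (auto simp: M.R.ring_axioms M.smult_l_distr M.smult_r_distr M.smult_assoc
      N.smult_l_distr N.smult_r_distr N.smult_assoc)
qed

text \<open>The copy of \<open>M\<close> along a map \<open>e\<close> that is injective on the
  carrier: \<open>d\<close> leads back to \<open>M\<close>, where the operations are
  performed.\<close>

definition transport ::
    "('b \<Rightarrow> 'c) \<Rightarrow> ('a, 'b, 'm) module_scheme \<Rightarrow> ('a, 'c) module" where
  "transport e M =
     (let d = inv_into (carrier M) e in
      \<lparr>carrier = e ` carrier M, mult = undefined, one = undefined,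
       zero = e \<zero>\<^bsub>M\<^esub>,
       add = (\<lambda>x y. e (d x \<oplus>\<^bsub>M\<^esub> d y)),
       smult = (\<lambda>a x. e (a \<odot>\<^bsub>M\<^esub> d x))\<rparr>)"

lemma carrier_transport [simp]: "carrier (transport e M) = e ` carrier M"
  by (simp add: transport_def Let_def)

text \<open>On elements \<open>e x\<close> with \<open>x\<close> in \<open>M\<close> the operations
  are the images of those of \<open>M\<close>, so every axiom results from applying \<open>e\<close>
  to the same axiom of \<open>M\<close>.\<close>

lemma
  assumes "inj_on e (carrier M)" "left_module R M"
  shows left_module_transport: "left_module R (transport e M)"
    and module_map_transport: "module_map R M (transport e M) e"
proof -
  interpret left_module R M by fact
  note inv_into_f_f[OF assms(1), simp]
  have [simp]: "\<zero>\<^bsub>transport e M\<^esub> = e \<zero>\<^bsub>M\<^esub>"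
    by (simp add: transport_def Let_def)
  have [simp]: "e x \<oplus>\<^bsub>transport e M\<^esub> e y = e (x \<oplus>\<^bsub>M\<^esub> y)"
    if "x \<in> carrier M" "y \<in> carrier M" for x y
    using that by (simp add: transport_def Let_def)
  have [simp]: "a \<odot>\<^bsub>transport e M\<^esub> e x = e (a \<odot>\<^bsub>M\<^esub> x)" if "x \<in> carrier M" for a x
    using that by (simp add: transport_def Let_def)
  show "module_map R M (transport e M) e"
    by (rule module_mapI) auto
  have inv: "\<exists>y\<in>carrier M. e (y \<oplus>\<^bsub>M\<^esub> x) = e \<zero>\<^bsub>M\<^esub>" if "x \<in> carrier M" for x
    using that by (intro bexI[of _ "\<ominus>\<^bsub>M\<^esub> x"]) (simp_all add: M.l_neg)
  show "left_module R (transport e M)"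
  proof (rule left_moduleI)
    show "abelian_group (transport e M)"
    proof (rule abelian_groupI)
      fix x y assume "x \<in> carrier (transport e M)" "y \<in> carrier (transport e M)"
      then show "x \<oplus>\<^bsub>transport e M\<^esub> y = y \<oplus>\<^bsub>transport e M\<^esub> x"
        by (auto simp: M.a_comm)
    qed (auto simp: inv M.a_assoc)
  qed (auto simp: R.ring_axioms smult_l_distr smult_r_distr smult_assoc)
qed

text \<open>Addition identifies the external with the internal direct sum: it is onto because
  \<open>A\<close> and \<open>B\<close> span \<open>M\<close>, and injective because they meet only
  in zero.\<close>

lemma (in left_module) module_map_internal_direct_sum:
  assumes A: "submodule A R M" and B: "submodule B R M"
    and sum: "A <+>\<^bsub>M\<^esub> B = carrier M" and inter: "A \<inter> B = {\<zero>\<^bsub>M\<^esub>}"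
  defines "D \<equiv> direct_sum (M\<lparr>carrier := A\<rparr>) (M\<lparr>carrier := B\<rparr>)"
  shows "module_map R D M (\<lambda>(x, y). x \<oplus>\<^bsub>M\<^esub> y)"
    and "bij_betw (\<lambda>(x, y). x \<oplus>\<^bsub>M\<^esub> y) (carrier D) (carrier M)"
proof -
  have carr: "x \<in> A \<Longrightarrow> x \<in> carrier M" "x \<in> B \<Longrightarrow> x \<in> carrier M" for x
    using A B by (auto simp: submodule_iff)
  show "module_map R D M (\<lambda>(x, y). x \<oplus>\<^bsub>M\<^esub> y)"
  proof (rule module_mapI)
    fix p q assume "p \<in> carrier D" "q \<in> carrier D"
    then show "(case p \<oplus>\<^bsub>D\<^esub> q of (x, y) \<Rightarrow> x \<oplus>\<^bsub>M\<^esub> y) =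
        (case p of (x, y) \<Rightarrow> x \<oplus>\<^bsub>M\<^esub> y) \<oplus>\<^bsub>M\<^esub> (case q of (x, y) \<Rightarrow> x \<oplus>\<^bsub>M\<^esub> y)"
      using carr by (auto simp: D_def M.a_ac)
  qed (use carr in \<open>auto simp: D_def smult_r_distr\<close>)
  have "a = a' \<and> b = b'"
    if ab: "a \<in> A" "a' \<in> A" "b \<in> B" "b' \<in> B" and eq: "a \<oplus>\<^bsub>M\<^esub> b = a' \<oplus>\<^bsub>M\<^esub> b'" for a a' b b'
  proof -
    have c: "a \<in> carrier M" "a' \<in> carrier M" "b \<in> carrier M" "b' \<in> carrier M"
      using ab carr by simp_all
    \<comment> \<open>The equation is rearranged to \<open>a - a' = b' - b\<close>. The left side
      lies in \<open>A\<close> and the right side in \<open>B\<close>, so both vanish.\<close>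
    have "b' = \<ominus>\<^bsub>M\<^esub> a' \<oplus>\<^bsub>M\<^esub> (a \<oplus>\<^bsub>M\<^esub> b)"
      unfolding eq using c by (simp add: M.r_neg1)
    then have "b' \<ominus>\<^bsub>M\<^esub> b = (\<ominus>\<^bsub>M\<^esub> a' \<oplus>\<^bsub>M\<^esub> (a \<oplus>\<^bsub>M\<^esub> b)) \<ominus>\<^bsub>M\<^esub> b"
      by simp
    also have "\<dots> = a \<ominus>\<^bsub>M\<^esub> a'"
      using c by (simp add: a_minus_def M.a_assoc M.r_neg) (simp add: M.a_comm)
    finally have d: "a \<ominus>\<^bsub>M\<^esub> a' = b' \<ominus>\<^bsub>M\<^esub> b" ..
    have "a \<ominus>\<^bsub>M\<^esub> a' \<in> A" "b' \<ominus>\<^bsub>M\<^esub> b \<in> B"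
      using ab c submodule_diff_mem_iff[OF A, of a a'] submodule_diff_mem_iff[OF B, of b' b]
      by simp_all
    then have "a \<ominus>\<^bsub>M\<^esub> a' = \<zero>\<^bsub>M\<^esub>"
      using d inter by (metis IntI singletonD)
    moreover have "a = (a \<ominus>\<^bsub>M\<^esub> a') \<oplus>\<^bsub>M\<^esub> a'"
      using c by (simp add: a_minus_def M.a_assoc M.l_neg)
    ultimately have "a = a'"
      using c by simp
    then show ?thesis
      using eq c by simp
  qed
  then have "inj_on (\<lambda>(x, y). x \<oplus>\<^bsub>M\<^esub> y) (A \<times> B)"
    by (intro inj_onI) auto
  moreover have "(\<lambda>(x, y). x \<oplus>\<^bsub>M\<^esub> y) ` (A \<times> B) = carrier M"
    unfolding sum[symmetric] set_add_def' by force
  ultimately show "bij_betw (\<lambda>(x, y). x \<oplus>\<^bsub>M\<^esub> y) (carrier D) (carrier M)"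
    by (simp add: bij_betw_def D_def)
qed

text \<open>The type \<open>'b + 'u\<close> is infinite because \<open>'u\<close> is, hence it is
  equipotent with its square; the second factor \<open>'b\<close> enters that square through
  \<open>Inl\<close>.\<close>

lemma ex_inj_prod_sum:
  includes cardinal_syntax
  shows "\<exists>e :: ('b + 'u::infinite) \<times> 'b \<Rightarrow> 'b + 'u. inj e"
proof -
  have "infinite (range (Inr :: 'u \<Rightarrow> 'b + 'u))"
    by (simp add: finite_image_iff inj_Inr infinite_UNIV)
  then have "infinite (UNIV :: ('b + 'u) set)"
    by (meson finite_subset subset_UNIV)
  then have "|UNIV \<times> UNIV :: (('b + 'u) \<times> ('b + 'u)) set| =o |UNIV :: ('b + 'u) set|"
    by (rule card_of_Times_same_infinite)
  then have "|UNIV \<times> UNIV :: (('b + 'u) \<times> ('b + 'u)) set| \<le>o |UNIV :: ('b + 'u) set|"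
    by (rule ordIso_imp_ordLeq)
  then obtain e :: "('b + 'u) \<times> ('b + 'u) \<Rightarrow> 'b + 'u" where "inj e"
    unfolding card_of_ordLeq[symmetric] by auto
  then have "inj (e \<circ> map_prod id Inl)"
    by (rule inj_compose) (simp add: prod.inj_map)
  then show ?thesis
    by blast
qed

section \<open>Passing from a module to its direct summands\<close>

theorem proposition2p4:
  fixes R :: "('a, 'r) ring_scheme"
    and M :: "('a, 'b, 'm) module_scheme"
    and A :: "'b set"
  assumes "ring R"
    and "left_module R M"
    and "rad_supplementing TYPE('u::infinite) R M"
    and "direct_summand R M A"
  shows "rad_supplementing TYPE('u) R (M\<lparr>carrier := A\<rparr>)"
  unfolding rad_supplementing_def
proof (intro allI impI)
  fix N :: "('a, 'b + 'u) module" and f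
  let ?A = "M\<lparr>carrier := A\<rparr>"
  assume "left_module R N \<and> module_embedding R ?A N f"
  then have N: "left_module R N" and f: "module_map R ?A N f" "inj_on f A"
    by (auto simp: module_embedding_iff)
  interpret M: left_module R M by fact
  interpret N: left_module R N by fact
  obtain B where A: "submodule A R M" and B: "submodule B R M"
    and AB: "A <+>\<^bsub>M\<^esub> B = carrier M" "A \<inter> B = {\<zero>\<^bsub>M\<^esub>}"
    using assms(4) by (auto simp: direct_summand_def)
  let ?B = "M\<lparr>carrier := B\<rparr>"
  have lA: "left_module R ?A" and lB: "left_module R ?B"
    using A B by (simp_all add: M.left_module_submodule)
  obtain e :: "('b + 'u) \<times> 'b \<Rightarrow> 'b + 'u" where e: "inj e"
    using ex_inj_prod_sum by blast
  let ?D = "direct_sum ?A ?B" and ?S = "direct_sum N ?B"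
  let ?P = "transport e ?S"
  let ?s = "\<lambda>(x, y). x \<oplus>\<^bsub>M\<^esub> y"
  \<comment> \<open>The embedding of \<open>M\<close> into the copy \<open>?P\<close> of the direct
    sum of \<open>N\<close> and \<open>B\<close>: split into components, apply \<open>f\<close> to
    the one in \<open>A\<close>, then move along \<open>e\<close>.\<close>
  let ?h = "e \<circ> (map_prod f id \<circ> inv_into (carrier ?D) ?s)"
  \<comment> \<open>The projection of \<open>?P\<close> onto \<open>N\<close>: undo
    \<open>e\<close>, then drop the component in \<open>B\<close>.\<close>
  let ?g = "fst \<circ> inv_into (carrier ?S) e"
  have S: "left_module R ?S"
    by (rule left_module_direct_sum[OF N lB])
  have e_on: "inj_on e (carrier ?S)"
    using e by (rule inj_on_subset) simp
  note s = M.module_map_internal_direct_sum[OF A B AB]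
  have P: "left_module R ?P" and e_map: "module_map R ?S ?P e"
    using left_module_transport[OF e_on S] module_map_transport[OF e_on S] by auto
  have s_inv: "bij_betw (inv_into (carrier ?D) ?s) (carrier M) (carrier ?D)"
    by (rule bij_betw_inv_into[OF s(2)])
  have prod_map: "module_map R ?D ?S (map_prod f id)"
    using module_mapD[OF f(1)] by (intro module_mapI) auto
  have h_map: "module_map R M ?P ?h"
    by (rule module_map_comp[OF module_map_comp[OF
          module_map_inv_into[OF left_module_direct_sum[OF lA lB] s] prod_map] e_map])
  have "inj_on (map_prod f id) (carrier ?D)"
    using f(2) by (auto simp: inj_on_def)
  then have "inj_on (map_prod f id \<circ> inv_into (carrier ?D) ?s) (carrier M)"
    using s_inv by (intro comp_inj_on) (simp_all only: bij_betw_def)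
  then have "inj_on ?h (carrier M)"
    by (rule comp_inj_on) (rule inj_on_subset[OF e subset_UNIV])
  then have "module_embedding R M ?P ?h"
    using h_map by (simp add: module_embedding_iff)
  then obtain V where V: "rad_supplement R ?P (?h ` carrier M) V"
    using assms(3) P unfolding rad_supplementing_def by blast
  \<comment> \<open>In these coordinates the image of \<open>M\<close> is visibly the sum of
    \<open>f(A)\<close> and \<open>B\<close>, so it contains the kernel of
    \<open>?g\<close>.\<close>
  have h_image: "?h ` carrier M = e ` (f ` A \<times> B)"
  proof -
    have "?h ` carrier M = e ` map_prod f id ` carrier ?D"
      using s_inv unfolding image_comp[symmetric] by (simp only: bij_betw_def)
    also have "map_prod f id ` carrier ?D = f ` A \<times> B"
      by (auto simp: map_prod_def)
    finally show ?thesis .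
  qed
  have "module_map R ?P ?S (inv_into (carrier ?S) e)"
    by (rule module_map_inv_into[OF S e_map]) (use e_on in \<open>simp add: bij_betw_def\<close>)
  moreover have "module_map R ?S N fst"
    by (rule module_mapI) auto
  ultimately have g_map: "module_map R ?P N ?g"
    by (rule module_map_comp)
  have g_e: "?g (e (x, b)) = x" if "x \<in> carrier N" "b \<in> B" for x b
    using that e_on by simp
  have zero: "\<zero>\<^bsub>M\<^esub> \<in> A" "\<zero>\<^bsub>M\<^esub> \<in> B"
    using A B by (auto simp: M.submodule_iff)
  \<comment> \<open>\<open>B\<close> contains zero and so is nonempty, whence the projection
    recovers all of \<open>X\<close>. Taking \<open>carrier N\<close> for \<open>X\<close> gives
    surjectivity of \<open>?g\<close>, and \<open>f(A)\<close> gives the image of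
    \<open>M\<close>.\<close>
  have g_image: "?g ` e ` (X \<times> B) = X" if "X \<subseteq> carrier N" for X
  proof -
    have "?g ` e ` (X \<times> B) = (\<lambda>p. ?g (e p)) ` (X \<times> B)"
      by (simp only: image_image)
    also have "\<dots> = fst ` (X \<times> B)"
      using that g_e by (intro image_cong) auto
    finally show ?thesis
      using zero by (auto simp: fst_image_times)
  qed
  have fA: "f ` A \<subseteq> carrier N"
    using module_mapD(1)[OF f(1)] by auto
  \<comment> \<open>Kernel elements of \<open>?g\<close> have the form \<open>e (0, b)\<close>; they
    lie in the image of \<open>M\<close> because zero belongs to \<open>f(A)\<close>.\<close>
  have f_zero: "\<zero>\<^bsub>N\<^esub> \<in> f ` A"
  proof -
    have "f \<zero>\<^bsub>M\<^esub> = \<zero>\<^bsub>N\<^esub>"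
      using module_mapD(1)[OF f(1), of "\<zero>\<^bsub>M\<^esub>"] module_mapD(3)[OF f(1), of "\<zero>\<^bsub>R\<^esub>" "\<zero>\<^bsub>M\<^esub>"] zero
      by simp
    then show ?thesis
      using zero by force
  qed
  interpret g: module_epi R ?P N ?g
    using P N g_map g_image[of "carrier N"]
    by (auto intro!: module_epi.intro module_epi_axioms.intro simp del: o_apply)
  have "rad_supplement R N (?g ` ?h ` carrier M) (?g ` V)"
  proof (rule g.rad_supplement_image[OF V])
    fix p assume "p \<in> carrier ?P" "?g p = \<zero>\<^bsub>N\<^esub>"
    then show "p \<in> ?h ` carrier M"
      unfolding h_image using f_zero g_e by auto
  qed
  then show "\<exists>V. rad_supplement R N (f ` carrier ?A) V"
    unfolding h_image g_image[OF fA] by auto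
qed

end
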